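(* Assume OCA (the Open Coloring Axiom). Let $G$ be a topological group containing a subspace $X$ homeomorphic to an uncountable subspace of the Sorgenfrey line. Then $G$ has uncountable spread, i.e. $s(G)>\omega$.
   Context: The Sorgenfrey line is the set of real numbers $\mathbb{R}$ endowed with the topology generated by the half-intervals $[a,b)$, where $a<b$ are arbitrary real numbers. For a topological space $Y$, the spread of $Y$ is the cardinal $s(Y)=\sup\{|D| : D\subset Y \text{ is a discrete subspace of } Y\}$. OCA (the Open Coloring Axiom, in Todorčević's form) is the following statement: for every separable metrizable space $S$ and every partition $[S]^2=K_0\cup K_1$ of the set of two-element subsets of $S$ such that $\{(x,y)\in S\times S: x\ne y,\ \{x,y\}\in K_0\}$ is open in $S\times S$, either there is an uncountable set $Y\subset S$ with $[Y]^2\subset K_0$, or $S=\bigcup_{n\in\omega}S_n$ for some sets $S_n$ with $[S_n]^2\subset K_1$ for all $n\in\omega$. *)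

theory Defs
  imports
    "HOL-Analysis.Analysis"
    "HOL-Library.Ramsey"
begin

unbundle cardinal_syntax

section \<open>The Sorgenfrey line\<close>

definition sorgenfrey_line :: "real topology" where
  "sorgenfrey_line = topology_generated_by {{a..<b} | a b. a < b}"

lemma topspace_sorgenfrey_line [simp]: "topspace sorgenfrey_line = UNIV"
proof -
  have "x \<in> \<Union>{{a..<b} | a b. a < b}" for x :: real
    by (rule UnionI[of "{x..<x + 1}"]) (fastforce, simp)
  then show ?thesis
    unfolding sorgenfrey_line_def topology_generated_by_topspace by blast
qed


section \<open>Spread\<close>

definition discrete_subspaces :: "'a topology \<Rightarrow> 'a set set" where
  "discrete_subspaces X = {D. D \<subseteq> topspace X \<and> subtopology X D = discrete_topology D}"

text \<open>
  Cardinals are represented as usual in the HOL cardinal library, by well-orders of minimal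
  length. A supremum of cardinals is a least upper bound with respect to the order of cardinals.
\<close>

definition is_card_Sup :: "'b rel set \<Rightarrow> 'a rel \<Rightarrow> bool" where
  "is_card_Sup R k \<longleftrightarrow>
     Card_order k \<and> (\<forall>r\<in>R. r \<le>o k) \<and>
     (\<forall>k' :: 'a rel. Card_order k' \<and> (\<forall>r\<in>R. r \<le>o k') \<longrightarrow> k \<le>o k')"

text \<open>
  The supremum of the sizes of the discrete subspaces is at most \<open>|UNIV :: 'a set|\<close>, so it is
  realised by a cardinal of type \<^typ>\<open>'a rel\<close>. It exists and is unique up to
  order isomorphism (\<open>is_card_Sup_spread\<close> and \<open>is_card_Sup_unique\<close> below).
\<close>

definition spread :: "'a topology \<Rightarrow> 'a rel" where
  "spread X = (SOME k. is_card_Sup (card_of ` discrete_subspaces X) k)"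

lemma is_card_Sup_spread: "is_card_Sup (card_of ` discrete_subspaces X) (spread X)"
proof -
  let ?S = "card_of ` discrete_subspaces X"
  let ?R = "{k :: 'a rel. Card_order k \<and> (\<forall>r\<in>?S. r \<le>o k)}"
  have "|UNIV :: 'a set| \<in> ?R"
    by (auto simp: card_of_Card_order intro: card_of_mono1)
  then have "?R \<noteq> {}" by blast
  then obtain k where "k \<in> ?R" "\<forall>k'\<in>?R. k \<le>o k'"
    using exists_minim_Card_order[of ?R] by blast
  then have "is_card_Sup ?S k"
    unfolding is_card_Sup_def by blast
  then show ?thesis
    unfolding spread_def by (rule someI)
qed

lemma is_card_Sup_unique:
  fixes k k' :: "'a rel"
  shows "is_card_Sup R k \<Longrightarrow> is_card_Sup R k' \<Longrightarrow> k =o k'"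
  unfolding is_card_Sup_def ordIso_iff_ordLeq by blast


section \<open>The Open Coloring Axiom\<close>

definition OCA_for :: "'a topology \<Rightarrow> bool" where
  "OCA_for S \<longleftrightarrow>
     (\<forall>K0 K1.
        K0 \<union> K1 = [topspace S]\<^bsup>2\<^esup> \<and> K0 \<inter> K1 = {} \<and>
        openin (prod_topology S S)
          {(x, y). x \<in> topspace S \<and> y \<in> topspace S \<and> x \<noteq> y \<and> {x, y} \<in> K0} \<longrightarrow>
        (\<exists>Y. Y \<subseteq> topspace S \<and> uncountable Y \<and> [Y]\<^bsup>2\<^esup> \<subseteq> K0) \<or>
        (\<exists>A :: nat \<Rightarrow> 'a set. topspace S = (\<Union>n. A n) \<and> (\<forall>n. [A n]\<^bsup>2\<^esup> \<subseteq> K1)))"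

text \<open>
  A formula cannot quantify over types, so the axiom quantifies over all separable metrizable
  topologies whose underlying set is an arbitrary set of reals. Such spaces have at
  most continuum many points, so up to homeomorphism these are all of them, and the axiom
  holds for spaces over every type; see \<open>OCA_imp_OCA_for\<close> below.
\<close>

definition OCA :: bool where
  "OCA \<longleftrightarrow> (\<forall>S :: real topology. separable_space S \<and> metrizable_space S \<longrightarrow> OCA_for S)"

lemma separable_metrizable_lepoll_real:
  assumes "separable_space X" "metrizable_space X"
  shows "topspace X \<lesssim> (UNIV :: real set)"
proof -
  obtain M d where M: "Metric_space M d" and X: "X = Metric_space.mtopology M d"
    using assms(2) unfolding metrizable_space_def by blast
  interpret Metric_space M d by (rule M)
  obtain C where C: "countable C" "C \<subseteq> M" "X closure_of C = M"
    using assms(1) unfolding separable_space_def X by auto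
  define g where "g = (\<lambda>x. {(c, q :: rat). c \<in> C \<and> d c x < of_rat q})"
  have "inj_on g M"
  proof (rule inj_onI, rule ccontr)
    fix x y assume xy: "x \<in> M" "y \<in> M" "g x = g y" "x \<noteq> y"
    then have "d x y > 0" by simp
    then obtain q where q: "0 < real_of_rat q" "real_of_rat q < d x y / 2"
      using of_rat_dense[of 0 "d x y / 2"] by (metis half_gt_zero)
    have "x \<in> X closure_of C" using C xy by simp
    then obtain c where c: "c \<in> C" "c \<in> mball x (of_rat q)"
      using q(1) unfolding X metric_closure_of by blast
    then have "(c, q) \<in> g x" by (auto simp: g_def commute)
    then have "d c y < of_rat q" using xy(3) by (auto simp: g_def)
    moreover have "d x c < of_rat q" using c by auto
    moreover have "d x y \<le> d x c + d c y" using xy c C by (intro triangle) auto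
    ultimately show False using q by linarith
  qed
  moreover have "g ` M \<subseteq> Pow (C \<times> UNIV)" by (auto simp: g_def)
  ultimately have "M \<lesssim> Pow (C \<times> (UNIV :: rat set))"
    unfolding lepoll_def by blast
  also have "Pow (C \<times> (UNIV :: rat set)) \<lesssim> (UNIV :: nat set set)"
  proof -
    have "countable (C \<times> (UNIV :: rat set))" using C by auto
    then have "C \<times> (UNIV :: rat set) \<lesssim> (UNIV :: nat set)"
      by (simp add: countable_lepoll lepoll_def countable_def)
    then obtain f :: "'a \<times> rat \<Rightarrow> nat" where "inj_on f (C \<times> UNIV)"
      unfolding lepoll_def by blast
    then have "inj_on ((`) f) (Pow (C \<times> UNIV))"
      by (rule inj_on_image_Pow)
    then show ?thesis unfolding lepoll_def by blast
  qed
  also have "(UNIV :: nat set set) \<lesssim> (UNIV :: real set)"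
    using nat_sets_eqpoll_reals by (rule eqpoll_imp_lepoll)
  finally show ?thesis unfolding X by simp
qed

lemma OCA_for_homeomorphic:
  assumes "OCA_for S" "homeomorphic_maps S T f g"
  shows "OCA_for T"
  unfolding OCA_for_def
proof (intro allI impI)
  fix K0 K1
  assume K: "K0 \<union> K1 = [topspace T]\<^bsup>2\<^esup> \<and> K0 \<inter> K1 = {} \<and>
        openin (prod_topology T T)
          {(x, y). x \<in> topspace T \<and> y \<in> topspace T \<and> x \<noteq> y \<and> {x, y} \<in> K0}"
  have cf: "continuous_map S T f" and cg: "continuous_map T S g"
    and gf: "\<And>x. x \<in> topspace S \<Longrightarrow> g (f x) = x"
    and fg: "\<And>y. y \<in> topspace T \<Longrightarrow> f (g y) = y"
    using assms(2) by (auto simp: homeomorphic_maps_def)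
  have fT: "\<And>x. x \<in> topspace S \<Longrightarrow> f x \<in> topspace T"
    and gS: "\<And>y. y \<in> topspace T \<Longrightarrow> g y \<in> topspace S"
    using cf cg by (auto simp: continuous_map_def)
  have f_inj: "\<And>x y. x \<in> topspace S \<Longrightarrow> y \<in> topspace S \<Longrightarrow> f x = f y \<longleftrightarrow> x = y"
    using gf by metis
  define L where "L = (\<lambda>K. {P \<in> [topspace S]\<^bsup>2\<^esup>. f ` P \<in> K})"
  have img: "f ` P \<in> [topspace T]\<^bsup>2\<^esup>" if "P \<in> [topspace S]\<^bsup>2\<^esup>" for P
  proof -
    obtain x y where "P = {x, y}" "x \<in> topspace S" "y \<in> topspace S" "x \<noteq> y"
      using \<open>P \<in> [topspace S]\<^bsup>2\<^esup>\<close> by (rule nsets2_E)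
    then show ?thesis using fT f_inj by simp
  qed
  have "L K0 \<union> L K1 = [topspace S]\<^bsup>2\<^esup>" "L K0 \<inter> L K1 = {}"
    using img K by (auto simp: L_def)
  moreover have "openin (prod_topology S S)
      {(x, y). x \<in> topspace S \<and> y \<in> topspace S \<and> x \<noteq> y \<and> {x, y} \<in> L K0}"
  proof -
    let ?U = "{(x, y). x \<in> topspace T \<and> y \<in> topspace T \<and> x \<noteq> y \<and> {x, y} \<in> K0}"
    let ?h = "\<lambda>(x, y). (f x, f y)"
    have "continuous_map (prod_topology S S) (prod_topology T T) ?h"
      using cf by (simp add: continuous_map_prod_top)
    then have "openin (prod_topology S S) {p \<in> topspace (prod_topology S S). ?h p \<in> ?U}"
      using K openin_continuous_map_preimage by blast
    moreover have "{p \<in> topspace (prod_topology S S). ?h p \<in> ?U} =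
        {(x, y). x \<in> topspace S \<and> y \<in> topspace S \<and> x \<noteq> y \<and> {x, y} \<in> L K0}"
      using fT f_inj by (auto simp: L_def)
    ultimately show ?thesis by simp
  qed
  ultimately have "(\<exists>Y. Y \<subseteq> topspace S \<and> uncountable Y \<and> [Y]\<^bsup>2\<^esup> \<subseteq> L K0) \<or>
      (\<exists>A :: nat \<Rightarrow> 'a set. topspace S = (\<Union>n. A n) \<and> (\<forall>n. [A n]\<^bsup>2\<^esup> \<subseteq> L K1))"
    using assms(1) unfolding OCA_for_def by blast
  moreover have sub: "[f ` Y]\<^bsup>2\<^esup> \<subseteq> K" if "[Y]\<^bsup>2\<^esup> \<subseteq> L K" for Y K
  proof
    fix P assume "P \<in> [f ` Y]\<^bsup>2\<^esup>"
    then obtain x y where "x \<in> Y" "y \<in> Y" "f x \<noteq> f y" "P = {f x, f y}"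
      by (elim nsets2_E) blast
    then have "{x, y} \<in> [Y]\<^bsup>2\<^esup>" "P = f ` {x, y}" by auto
    then show "P \<in> K" using that unfolding L_def by blast
  qed
  ultimately show "(\<exists>Y. Y \<subseteq> topspace T \<and> uncountable Y \<and> [Y]\<^bsup>2\<^esup> \<subseteq> K0) \<or>
        (\<exists>A :: nat \<Rightarrow> 'b set. topspace T = (\<Union>n. A n) \<and> (\<forall>n. [A n]\<^bsup>2\<^esup> \<subseteq> K1))"
  proof (elim disjE exE conjE)
    fix Y assume Y: "Y \<subseteq> topspace S" "uncountable Y" "[Y]\<^bsup>2\<^esup> \<subseteq> L K0"
    have "inj_on f Y" using f_inj Y(1) by (auto simp: inj_on_def)
    then have "uncountable (f ` Y)" using Y(2) countable_image_inj_on by blast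
    moreover have "f ` Y \<subseteq> topspace T" using Y(1) fT by auto
    ultimately show ?thesis using sub[OF Y(3)] by (intro disjI1 exI[of _ "f ` Y"]) simp
  next
    fix A :: "nat \<Rightarrow> 'a set"
    assume A: "topspace S = (\<Union>n. A n)" "\<forall>n. [A n]\<^bsup>2\<^esup> \<subseteq> L K1"
    have "y \<in> f ` topspace S" if "y \<in> topspace T" for y
      using fg[OF that] gS[OF that] by (metis imageI)
    then have "topspace T = f ` topspace S" using fT by auto
    then have "topspace T = (\<Union>n. f ` A n)" using A(1) by auto
    moreover have "\<forall>n. [f ` A n]\<^bsup>2\<^esup> \<subseteq> K1" using sub A(2) by simp
    ultimately show ?thesis by (intro disjI2 exI[of _ "\<lambda>n. f ` A n"]) simp
  qed
qed

lemma OCA_imp_OCA_for: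
  fixes X :: "'a topology"
  assumes OCA "separable_space X" "metrizable_space X"
  shows "OCA_for X"
proof -
  obtain f :: "'a \<Rightarrow> real" where f: "inj_on f (topspace X)"
    using separable_metrizable_lepoll_real[OF assms(2,3)] unfolding lepoll_def by blast
  define g where "g = inv_into (topspace X) f"
  define S where "S = pullback_topology (f ` topspace X) g X"
  have gf: "g (f x) = x" if "x \<in> topspace X" for x
    using f that by (simp add: g_def)
  have tS: "topspace S = f ` topspace X"
    using gf by (auto simp: S_def topspace_pullback_topology)
  have "continuous_map S X g"
    unfolding S_def using continuous_map_pullback[OF continuous_map_id, of _ g X] by simp
  moreover have "continuous_map X S f"
    unfolding S_def
  proof (rule continuous_map_pullback')
    show "continuous_map X X (g \<circ> f)"
      by (rule continuous_map_eq[OF continuous_map_id]) (simp add: gf)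
  qed auto
  ultimately have h: "homeomorphic_maps S X g f"
    unfolding homeomorphic_maps_def tS using gf by auto
  then have "S homeomorphic_space X" unfolding homeomorphic_space_def by blast
  then have "separable_space S" "metrizable_space S"
    using assms(2,3) homeomorphic_separable_space homeomorphic_metrizable_space by blast+
  then show ?thesis
    using assms(1) OCA_for_homeomorphic[OF _ h] unfolding OCA_def by blast
qed

end

theory Submission
  imports Defs "HOL-Library.Countable_Set_Type"
begin

text \<open>
  Write \<open>x\<^sub>t\<close> for the point of \<open>X\<close> that corresponds to \<open>t \<in> Y\<close>. The proof sees the
  Sorgenfrey line as a one-sided structure: points \<open>x\<^sub>s\<close> with \<open>s\<close> slightly above \<open>t\<close> are close
  to \<open>x\<^sub>t\<close>, while a neighbourhood of \<open>x\<^sub>t\<close> excludes all \<open>x\<^sub>s\<close> with \<open>s < t\<close>.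

  Axiom OCA is applied to the plane set \<open>Y \<times> Y\<close>, where the open colour consists of the pairs of
  points in strictly decreasing position. It provides an uncountable set
  \<open>D \<subseteq> Y \<times> Y\<close> all of whose pairs are in decreasing position
  (\<open>OCA_imp_uncountable_antichain\<close>), because \<open>Y \<times> Y\<close> is not a union of countably
  many chains of the product order (\<open>square_not_countable_union_of_chains\<close>).

  To each \<open>(a, b) \<in> D\<close> belongs the group element \<open>x\<^sub>a + x\<^sub>b\<close>. Let \<open>(a', b') \<in> D\<close> be another
  point such that \<open>x\<^sub>a\<^sub>' + x\<^sub>b\<^sub>'\<close> is close to \<open>x\<^sub>a + x\<^sub>b\<close>. If \<open>a'\<close> is slightly
  above \<open>a\<close>, then \<open>x\<^sub>a\<^sub>'\<close> is close to \<open>x\<^sub>a\<close>, so cancelling in the group shows that \<open>x\<^sub>b\<^sub>'\<close> is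
  close to \<open>x\<^sub>b\<close>, which contradicts \<open>b' < b\<close>; if \<open>b'\<close> is slightly above \<open>b\<close>, the argument is
  symmetric (\<open>cancellation_forces_le\<close>). Thus \<open>x\<^sub>a + x\<^sub>b\<close> is isolated from the sums whose indices lie
  in some quadrant \<open>{..<r} \<times> {..<r'}\<close> around \<open>(a, b)\<close>. There are only countably many quadrants with
  rational corner, so one of them serves uncountably many points of \<open>D\<close>, and their sums form an
  uncountable discrete subspace.
\<close>

section \<open>Uncountable antichains in squares\<close>

text \<open>
  The pigeonhole form in which uncountability is used: a map into a countable type is constant on
  an uncountable subset.
\<close>

lemma uncountable_fibre:
  fixes f :: "'a \<Rightarrow> 'b :: countable"
  assumes "uncountable A"
  obtains c where "uncountable {a \<in> A. f a = c}"
proof -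
  have "A = (\<Union>c. {a \<in> A. f a = c})" by blast
  then have "\<not> (\<forall>c. countable {a \<in> A. f a = c})"
    using assms countable_UN[of UNIV "\<lambda>c. {a \<in> A. f a = c}"] by auto
  then show thesis using that by blast
qed

abbreviation decreasing_pair :: "real \<times> real \<Rightarrow> real \<times> real \<Rightarrow> bool" where
  "decreasing_pair p q \<equiv> (fst p - fst q) * (snd p - snd q) < 0"

text \<open>
  Every horizontal section of \<open>Y \<times> Y\<close> is uncountable, so one of the countably many chains contains a
  nondegenerate part of it, hence reaches to both sides of some rational number. One chain can
  cross the same vertical line in this way at one height only. So the heights in \<open>Y\<close> are
  determined by countable data.
\<close>

lemma square_not_countable_union_of_chains:
  fixes Y :: "real set" and A :: "nat \<Rightarrow> (real \<times> real) set"
  assumes "uncountable Y" and cover: "Y \<times> Y \<subseteq> (\<Union>n. A n)"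
    and chain: "\<And>n p q. p \<in> A n \<Longrightarrow> q \<in> A n \<Longrightarrow> \<not> decreasing_pair p q"
  shows False
proof -
  have "\<exists>n r x x'. (x, y) \<in> A n \<and> (x', y) \<in> A n \<and> x < real_of_rat r \<and> real_of_rat r < x'"
    if "y \<in> Y" for y
  proof -
    have "\<forall>x\<in>Y. \<exists>n. (x, y) \<in> A n" using cover that by blast
    then obtain N where N: "\<forall>x\<in>Y. (x, y) \<in> A (N x)" by metis
    obtain n where n: "uncountable {x \<in> Y. N x = n}"
      using uncountable_fibre[OF assms(1)] by blast
    then have inf: "infinite {x \<in> Y. N x = n}" using countable_finite by blast
    then have "{x \<in> Y. N x = n} \<noteq> {}" by fastforce
    then obtain x where x: "x \<in> Y" "N x = n" by blast
    have "\<not> {x \<in> Y. N x = n} \<subseteq> {x}"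
      using inf finite_subset by blast
    then obtain x' where x': "x' \<in> Y" "N x' = n" "x' \<noteq> x" by blast
    have *: "(x, y) \<in> A n" "(x', y) \<in> A n" using N x x' by auto
    consider "x < x'" | "x' < x" using x'(3) by linarith
    then show ?thesis
    proof cases
      case 1
      then obtain r where "x < real_of_rat r" "real_of_rat r < x'" using of_rat_dense by blast
      then show ?thesis using * by blast
    next
      case 2
      then obtain r where "x' < real_of_rat r" "real_of_rat r < x" using of_rat_dense by blast
      then show ?thesis using * by blast
    qed
  qed
  then obtain n r u v where w: "\<And>y. y \<in> Y \<Longrightarrow> (u y, y) \<in> A (n y) \<and> (v y, y) \<in> A (n y) \<and>
      u y < real_of_rat (r y) \<and> real_of_rat (r y) < v y"
    by metis
  have le: "y' \<le> y" if "y \<in> Y" "y' \<in> Y" "(n y, r y) = (n y', r y')" for y y'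
  proof (rule ccontr)
    assume "\<not> y' \<le> y"
    moreover have "u y' < v y" using w[OF that(1)] w[OF that(2)] that(3) by auto
    ultimately have "decreasing_pair (v y, y) (u y', y')" by (simp add: mult_pos_neg)
    then show False using chain[of "(v y, y)" "n y" "(u y', y')"] w[OF that(1)] w[OF that(2)] that(3) by auto
  qed
  have "inj_on (\<lambda>y. (n y, r y)) Y" by (rule inj_onI, rule antisym) (use le in auto)
  then show False using assms(1) by (metis countableI_type countable_image_inj_on)
qed

text \<open>
  Decreasing position is given by a strict inequality between continuous functions, so it is an
  open colour. The pieces of the other alternative of OCA would be chains covering the square.
\<close>

lemma OCA_imp_uncountable_antichain:
  fixes Y :: "real set"
  assumes OCA "uncountable Y"
  obtains D where "D \<subseteq> Y \<times> Y" "uncountable D"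
    "\<And>p q. p \<in> D \<Longrightarrow> q \<in> D \<Longrightarrow> p \<noteq> q \<Longrightarrow> decreasing_pair p q"
proof -
  let ?S = "subtopology (euclidean :: (real \<times> real) topology) (Y \<times> Y)"
  have "metrizable_space ?S"
    by (simp add: metrizable_space_euclidean metrizable_space_subtopology)
  moreover have "separable_space ?S"
  proof -
    obtain C where C: "countable C" "C \<subseteq> Y \<times> Y" "Y \<times> Y \<subseteq> closure C"
      using separable by blast
    then have "?S closure_of C = Y \<times> Y"
      by (auto simp: closure_of_subtopology Int_absorb1)
    then show ?thesis using C unfolding separable_space_def by auto
  qed
  ultimately have oca: "OCA_for ?S" using OCA_imp_OCA_for assms(1) by blast
  define K0 where "K0 = {{p, q} | p q. p \<in> Y \<times> Y \<and> q \<in> Y \<times> Y \<and> decreasing_pair p q}"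
  have sym: "decreasing_pair q p \<longleftrightarrow> decreasing_pair p q" for p q
    by (auto simp: mult_less_0_iff)
  have K0_iff: "{p, q} \<in> K0 \<longleftrightarrow> p \<in> Y \<times> Y \<and> q \<in> Y \<times> Y \<and> decreasing_pair p q" for p q
  proof
    assume "{p, q} \<in> K0"
    then obtain p' q' where "{p, q} = {p', q'}" "p' \<in> Y \<times> Y" "q' \<in> Y \<times> Y" "decreasing_pair p' q'"
      unfolding K0_def by blast
    then show "p \<in> Y \<times> Y \<and> q \<in> Y \<times> Y \<and> decreasing_pair p q"
      using sym by (metis doubleton_eq_iff)
  next
    assume "p \<in> Y \<times> Y \<and> q \<in> Y \<times> Y \<and> decreasing_pair p q"
    then show "{p, q} \<in> K0" unfolding K0_def by blast
  qed
  have K0_sub: "K0 \<subseteq> [Y \<times> Y]\<^bsup>2\<^esup>"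
    unfolding K0_def by auto
  have "open {z :: (real \<times> real) \<times> (real \<times> real). decreasing_pair (fst z) (snd z)}"
    by (intro open_Collect_less continuous_intros)
  then have "openin (prod_topology ?S ?S)
      (((Y \<times> Y) \<times> (Y \<times> Y)) \<inter> {z. decreasing_pair (fst z) (snd z)})"
    by (simp add: openin_open_Int)
  also have "((Y \<times> Y) \<times> (Y \<times> Y)) \<inter> {z. decreasing_pair (fst z) (snd z)} =
      {(p, q). p \<in> topspace ?S \<and> q \<in> topspace ?S \<and> p \<noteq> q \<and> {p, q} \<in> K0}"
    by (auto simp: K0_iff)
  finally have "(\<exists>D. D \<subseteq> topspace ?S \<and> uncountable D \<and> [D]\<^bsup>2\<^esup> \<subseteq> K0) \<or>
      (\<exists>A :: nat \<Rightarrow> (real \<times> real) set. topspace ?S = (\<Union>n. A n) \<and> (\<forall>n. [A n]\<^bsup>2\<^esup> \<subseteq> [Y \<times> Y]\<^bsup>2\<^esup> - K0))"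
    using K0_sub oca[unfolded OCA_for_def, rule_format, of K0 "[Y \<times> Y]\<^bsup>2\<^esup> - K0"] by auto
  then show thesis
  proof (elim disjE exE conjE)
    fix D assume D: "D \<subseteq> topspace ?S" "uncountable D" "[D]\<^bsup>2\<^esup> \<subseteq> K0"
    have "decreasing_pair p q" if "p \<in> D" "q \<in> D" "p \<noteq> q" for p q
    proof -
      have "{p, q} \<in> [D]\<^bsup>2\<^esup>" using that by simp
      then show ?thesis using D(3) K0_iff by blast
    qed
    then show thesis using that D by auto
  next
    fix A :: "nat \<Rightarrow> (real \<times> real) set"
    assume A: "topspace ?S = (\<Union>n. A n)" "\<forall>n. [A n]\<^bsup>2\<^esup> \<subseteq> [Y \<times> Y]\<^bsup>2\<^esup> - K0"
    have "\<not> decreasing_pair p q" if "p \<in> A n" "q \<in> A n" for n p q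
    proof
      assume d: "decreasing_pair p q"
      then have "{p, q} \<in> [A n]\<^bsup>2\<^esup>" using that by auto
      moreover have "p \<in> Y \<times> Y" "q \<in> Y \<times> Y" using that A(1) by auto
      ultimately show False using A(2) K0_iff d by blast
    qed
    then show thesis using square_not_countable_union_of_chains[of Y A] assms(2) A(1) by auto
  qed
qed


section \<open>Sorgenfrey subspaces of a topological space\<close>

lemma openin_sorgenfrey_line_right_interval:
  assumes "openin sorgenfrey_line U" "x \<in> U"
  obtains e where "0 < e" "{x..<x + e} \<subseteq> U"
proof -
  have "generate_topology_on {{a..<b} | a b. a < (b :: real)} U"
    using assms(1) by (simp add: sorgenfrey_line_def openin_topology_generated_by_iff)
  then have "x \<in> U \<Longrightarrow> \<exists>e>0. {x..<x + e} \<subseteq> U"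
  proof (induction rule: generate_topology_on.induct)
    case (Int U V)
    then obtain d e where "0 < d" "{x..<x + d} \<subseteq> U" "0 < e" "{x..<x + e} \<subseteq> V" by auto
    then have "0 < min d e \<and> {x..<x + min d e} \<subseteq> U \<inter> V" by fastforce
    then show ?case by blast
  next
    case (UN \<K>)
    then show ?case by blast
  next
    case (Basis s)
    then obtain a b where "s = {a..<b}" "a \<le> x" "x < b" by auto
    then have "0 < b - x \<and> {x..<x + (b - x)} \<subseteq> s" by auto
    then show ?case by blast
  qed auto
  then show thesis using that assms(2) by blast
qed

text \<open>
  All that is used of an embedding of \<open>Y\<close> with the Sorgenfrey topology: continuity from the right,
  and neighbourhoods that see only larger parameters.
\<close>

definition sorgenfrey_family :: "real set \<Rightarrow> (real \<Rightarrow> 'a :: topological_space) \<Rightarrow> bool" where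
  "sorgenfrey_family Y x \<longleftrightarrow>
     (\<forall>a\<in>Y. \<forall>V. open V \<and> x a \<in> V \<longrightarrow> (\<exists>e>0. \<forall>c\<in>Y. a \<le> c \<and> c < a + e \<longrightarrow> x c \<in> V)) \<and>
     (\<forall>a\<in>Y. \<exists>V. open V \<and> x a \<in> V \<and> (\<forall>c\<in>Y. x c \<in> V \<longrightarrow> a \<le> c))"

lemma homeomorphic_sorgenfrey_imp_sorgenfrey_family:
  fixes X :: "'a :: topological_space set" and Y :: "real set"
  assumes "subtopology euclidean X homeomorphic_space subtopology sorgenfrey_line Y"
  shows "\<exists>x :: real \<Rightarrow> 'a. sorgenfrey_family Y x"
proof -
  let ?T = "subtopology euclidean X" and ?L = "subtopology sorgenfrey_line Y"
  obtain g x where "homeomorphic_maps ?T ?L g x"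
    using assms unfolding homeomorphic_space_def by blast
  then have cg: "continuous_map ?T ?L g" and cx: "continuous_map ?L ?T x"
    and gx: "\<And>c. c \<in> Y \<Longrightarrow> g (x c) = c"
    by (auto simp: homeomorphic_maps_def)
  have xX: "x c \<in> X" if "c \<in> Y" for c
    using cx that by (auto simp: continuous_map_def)
  have "sorgenfrey_family Y x"
    unfolding sorgenfrey_family_def
  proof (intro conjI ballI allI impI)
    fix a V assume a: "a \<in> Y" "open V \<and> x a \<in> V"
    then have "openin ?T (X \<inter> V)" by (simp add: openin_open_Int)
    then have "openin ?L {c \<in> topspace ?L. x c \<in> X \<inter> V}"
      using cx openin_continuous_map_preimage by blast
    then obtain U where U: "openin sorgenfrey_line U" "{c \<in> topspace ?L. x c \<in> X \<inter> V} = U \<inter> Y"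
      by (auto simp: openin_subtopology)
    then have "a \<in> U" using a xX by auto
    then obtain e where "0 < e" "{a..<a + e} \<subseteq> U"
      using openin_sorgenfrey_line_right_interval U(1) by blast
    then show "\<exists>e>0. \<forall>c\<in>Y. a \<le> c \<and> c < a + e \<longrightarrow> x c \<in> V"
      using U(2) by (intro exI[of _ e]) auto
  next
    fix a assume a: "a \<in> Y"
    have "openin sorgenfrey_line {a..<a + 1}"
      unfolding sorgenfrey_line_def by (rule topology_generated_by_Basis) force
    then have "openin ?L ({a..<a + 1} \<inter> Y)" by (auto simp: openin_subtopology)
    then have "openin ?T {z \<in> topspace ?T. g z \<in> {a..<a + 1} \<inter> Y}"
      using cg openin_continuous_map_preimage by blast
    then obtain V where V: "open V" "{z \<in> X. g z \<in> {a..<a + 1} \<inter> Y} = X \<inter> V"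
      by (auto simp: openin_open)
    have mem: "x c \<in> V \<longleftrightarrow> c \<in> {a..<a + 1}" if "c \<in> Y" for c
    proof -
      have "x c \<in> V \<longleftrightarrow> x c \<in> X \<inter> V" using xX[OF that] by blast
      also have "\<dots> \<longleftrightarrow> c \<in> {a..<a + 1}"
        unfolding V(2)[symmetric] using gx[OF that] xX[OF that] that by simp
      finally show ?thesis .
    qed
    then show "\<exists>V. open V \<and> x a \<in> V \<and> (\<forall>c\<in>Y. x c \<in> V \<longrightarrow> a \<le> c)"
      using V(1) a by (intro exI[of _ V]) auto
  qed
  then show ?thesis by blast
qed


section \<open>Discrete sets of sums\<close>

text \<open>
  The cancellation argument: if \<open>f g h\<close> recovers a second element from a first element \<open>g\<close> and a
  combination \<open>h\<close> of the two, then a combination close to the given one, with first element just to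
  the right of \<open>x\<^sub>a\<close>, has its second element close to \<open>x\<^sub>b\<close>, and so its second parameter is at
  least \<open>b\<close>. Both sides of a noncommutative sum are covered by letting \<open>f\<close> cancel on the left
  or on the right.
\<close>

lemma cancellation_forces_le:
  fixes x :: "real \<Rightarrow> 'a :: topological_space" and f :: "'a \<Rightarrow> 'a \<Rightarrow> 'a"
  assumes x: "sorgenfrey_family Y x"
    and cont: "continuous_on UNIV (\<lambda>(g, h). f g h)"
    and ab: "a \<in> Y" "b \<in> Y" and z: "f (x a) z = x b"
  obtains r :: rat and Q where "a < of_rat r" "open Q" "z \<in> Q"
    "\<And>a' b' h. a' \<in> Y \<Longrightarrow> b' \<in> Y \<Longrightarrow> a \<le> a' \<Longrightarrow> a' < of_rat r \<Longrightarrow> h \<in> Q \<Longrightarrow> f (x a') h = x b' \<Longrightarrow> b \<le> b'"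
proof -
  obtain N where N: "open N" "x b \<in> N" "\<forall>c\<in>Y. x c \<in> N \<longrightarrow> b \<le> c"
    using x ab(2) unfolding sorgenfrey_family_def by meson
  have "open ((\<lambda>(g, h). f g h) -` N)" using cont N(1) by (simp add: open_vimage)
  moreover have "(x a, z) \<in> (\<lambda>(g, h). f g h) -` N" using z N(2) by simp
  ultimately obtain P Q where PQ: "open P" "open Q" "x a \<in> P" "z \<in> Q"
      "P \<times> Q \<subseteq> (\<lambda>(g, h). f g h) -` N"
    by (elim open_prod_elim) auto
  obtain e where e: "0 < e" "\<forall>c\<in>Y. a \<le> c \<and> c < a + e \<longrightarrow> x c \<in> P"
    using x ab(1) PQ(1,3) unfolding sorgenfrey_family_def by meson
  obtain r where r: "a < of_rat r" "of_rat r < a + e"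
    using of_rat_dense[of a "a + e"] e(1) by auto
  show thesis
  proof (rule that[of r Q])
    fix a' b' h
    assume *: "a' \<in> Y" "b' \<in> Y" "a \<le> a'" "a' < of_rat r" "h \<in> Q" "f (x a') h = x b'"
    then have "x a' \<in> P" using e(2) r(2) by auto
    then have "f (x a') h \<in> N" using PQ(5) *(5) by auto
    then show "b \<le> b'" using N(3) * by auto
  qed (use r PQ in auto)
qed

text \<open>
  An indexed family in which each term has a neighbourhood that contains no other term is injective,
  which keeps its range uncountable.
\<close>

lemma uncountable_discrete_subspace_of_isolated_family:
  fixes z :: "'b \<Rightarrow> 'a :: topological_space"
  assumes "uncountable D"
    and iso: "\<And>p. p \<in> D \<Longrightarrow> \<exists>Q. open Q \<and> z p \<in> Q \<and> (\<forall>q\<in>D. z q \<in> Q \<longrightarrow> q = p)"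
  shows "z ` D \<in> discrete_subspaces euclidean" "uncountable (z ` D)"
proof -
  have "inj_on z D" using iso by (metis inj_onI)
  then show "uncountable (z ` D)" using assms(1) countable_image_inj_on by blast
  have "\<exists>T. open T \<and> {z p} = T \<inter> z ` D" if p: "p \<in> D" for p
  proof -
    obtain Q where "open Q" "z p \<in> Q" "\<forall>q\<in>D. z q \<in> Q \<longrightarrow> q = p" using iso[OF p] by meson
    moreover from this have "{z p} = Q \<inter> z ` D" using p by blast
    ultimately show ?thesis by blast
  qed
  then have "\<forall>y\<in>z ` D. openin (subtopology euclidean (z ` D)) {y}"
    by (auto simp: openin_subtopology)
  then have "discrete_topology (z ` D) = subtopology euclidean (z ` D)"
    by (subst discrete_topology_unique) auto
  then show "z ` D \<in> discrete_subspaces euclidean"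
    by (simp add: discrete_subspaces_def)
qed

text \<open>
  A sum over \<open>D\<close> may well be a limit of sums with distant indices, so the family of all sums need
  not be isolated. Restricting to the points of \<open>D\<close> with a common rational quadrant makes the
  local isolation global.
\<close>

lemma uncountable_discrete_subspace_of_sums:
  fixes x :: "real \<Rightarrow> 'g :: topological_group_add"
  assumes x: "sorgenfrey_family Y x"
    and D: "D \<subseteq> Y \<times> Y" "uncountable D"
      "\<And>p q. p \<in> D \<Longrightarrow> q \<in> D \<Longrightarrow> p \<noteq> q \<Longrightarrow> decreasing_pair p q"
  obtains E :: "'g set" where "E \<in> discrete_subspaces euclidean" "uncountable E"
proof -
  define z where "z = (\<lambda>p. x (fst p) + x (snd p))"
  \<comment> \<open>The quadrant at \<open>c\<close> keeps the larger coordinate of \<open>q\<close> within the range of right continuity: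
      of two points in decreasing position, each exceeds the other in exactly one coordinate.\<close>
  have "\<exists>c :: rat \<times> rat. \<exists>Q. fst p < of_rat (fst c) \<and> snd p < of_rat (snd c) \<and> open Q \<and> z p \<in> Q \<and>
      (\<forall>q\<in>D. fst q < of_rat (fst c) \<and> snd q < of_rat (snd c) \<and> z q \<in> Q \<longrightarrow> q = p)"
    if p: "p \<in> D" for p
  proof -
    obtain a b where ab: "p = (a, b)" "a \<in> Y" "b \<in> Y" using p D(1) by auto
    have cl: "continuous_on UNIV (\<lambda>(g :: 'g, h). - g + h)"
      and cr: "continuous_on UNIV (\<lambda>(g :: 'g, h). h - g)"
      by (auto simp: case_prod_beta intro!: continuous_intros)
    have fl: "- x a + z p = x b" and fr: "z p - x b = x a"
      by (simp_all add: z_def ab(1) add.assoc[symmetric])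
    obtain r Q where Q: "a < of_rat r" "open Q" "z p \<in> Q"
      "\<And>a' b' h. a' \<in> Y \<Longrightarrow> b' \<in> Y \<Longrightarrow> a \<le> a' \<Longrightarrow> a' < of_rat r \<Longrightarrow> h \<in> Q \<Longrightarrow> - x a' + h = x b' \<Longrightarrow> b \<le> b'"
      by (rule cancellation_forces_le[OF x cl ab(2,3) fl]) (rule that)
    obtain r' Q' where Q': "b < of_rat r'" "open Q'" "z p \<in> Q'"
      "\<And>b' a' h. b' \<in> Y \<Longrightarrow> a' \<in> Y \<Longrightarrow> b \<le> b' \<Longrightarrow> b' < of_rat r' \<Longrightarrow> h \<in> Q' \<Longrightarrow> h - x b' = x a' \<Longrightarrow> a \<le> a'"
      by (rule cancellation_forces_le[OF x cr ab(3,2) fr]) (rule that)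
    have "q = p" if q: "q \<in> D" "fst q < of_rat r" "snd q < of_rat r'" "z q \<in> Q \<inter> Q'" for q
    proof (rule ccontr)
      assume "q \<noteq> p"
      obtain a' b' where ab': "q = (a', b')" "a' \<in> Y" "b' \<in> Y" using q(1) D(1) by auto
      have "- x a' + z q = x b'" "z q - x b' = x a'"
        by (simp_all add: z_def ab'(1) add.assoc[symmetric])
      then have "a \<le> a' \<Longrightarrow> b \<le> b'" "b \<le> b' \<Longrightarrow> a \<le> a'"
        using Q(4)[of a' b' "z q"] Q'(4)[of b' a' "z q"] q ab' by auto
      moreover have "(a' - a) * (b' - b) < 0"
        using D(3)[OF q(1) p \<open>q \<noteq> p\<close>] by (simp add: ab(1) ab'(1))
      ultimately show False by (auto simp: mult_less_0_iff)
    qed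
    then show ?thesis using Q Q' ab(1)
      by (intro exI[of _ "(r, r')"] exI[of _ "Q \<inter> Q'"]) auto
  qed
  then obtain c where c: "\<And>p. p \<in> D \<Longrightarrow> \<exists>Q. fst p < real_of_rat (fst (c p)) \<and> snd p < real_of_rat (snd (c p)) \<and>
      open Q \<and> z p \<in> Q \<and>
      (\<forall>q\<in>D. fst q < real_of_rat (fst (c p)) \<and> snd q < real_of_rat (snd (c p)) \<and> z q \<in> Q \<longrightarrow> q = p)"
    by metis
  obtain k where k: "uncountable {p \<in> D. c p = k}" using uncountable_fibre[OF D(2)] by blast
  have "\<exists>Q. open Q \<and> z p \<in> Q \<and> (\<forall>q\<in>{p \<in> D. c p = k}. z q \<in> Q \<longrightarrow> q = p)"
    if "p \<in> {p \<in> D. c p = k}" for p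
  proof -
    have pk: "p \<in> D" "c p = k" using that by auto
    obtain Q where Q: "open Q" "z p \<in> Q"
      "\<forall>q\<in>D. fst q < real_of_rat (fst k) \<and> snd q < real_of_rat (snd k) \<and> z q \<in> Q \<longrightarrow> q = p"
      using c[OF pk(1)] unfolding pk(2) by blast
    have "fst q < real_of_rat (fst k) \<and> snd q < real_of_rat (snd k)" if "q \<in> D" "c q = k" for q
      using c[OF that(1)] unfolding that(2) by blast
    then show ?thesis using Q by blast
  qed
  then show thesis
    using that uncountable_discrete_subspace_of_isolated_family[OF k, of z] by blast
qed

lemma natLeq_less_spread:
  assumes "E \<in> discrete_subspaces T" "uncountable E"
  shows "natLeq <o spread T"
proof -
  have "|E| \<le>o spread T"
    using is_card_Sup_spread[of T] assms(1) by (auto simp: is_card_Sup_def)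
  moreover have "natLeq <o |E|"
  proof -
    have "\<not> |E| \<le>o natLeq"
      using assms(2) by (simp add: countable_card_le_natLeq)
    then show ?thesis
      using not_ordLeq_iff_ordLess[OF natLeq_Well_order card_of_Well_order, of E]
        not_ordLeq_iff_ordLess[OF card_of_Well_order natLeq_Well_order, of E] by blast
  qed
  ultimately show ?thesis by (rule ordLess_ordLeq_trans[rotated])
qed

theorem corollary3:
  fixes X :: "'g::topological_group_add set" and Y :: "real set"
  assumes "OCA"
    and "uncountable Y"
    and "subtopology (euclidean :: 'g topology) X homeomorphic_space subtopology sorgenfrey_line Y"
  shows "natLeq <o spread (euclidean :: 'g topology)"
proof -
  obtain D where D: "D \<subseteq> Y \<times> Y" "uncountable D"
    "\<And>p q. p \<in> D \<Longrightarrow> q \<in> D \<Longrightarrow> p \<noteq> q \<Longrightarrow> decreasing_pair p q"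
    using OCA_imp_uncountable_antichain[OF assms(1,2)] by blast
  obtain x :: "real \<Rightarrow> 'g" where "sorgenfrey_family Y x"
    using homeomorphic_sorgenfrey_imp_sorgenfrey_family[OF assms(3)] by blast
  then obtain E :: "'g set" where "E \<in> discrete_subspaces euclidean" "uncountable E"
    using uncountable_discrete_subspace_of_sums[of Y x D] D by blast
  then show ?thesis by (rule natLeq_less_spread)
qed

end
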